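(* Let $\mathcal{G}$ be a connected undirected graph on $V=\{1,\dots,n\}$ with Laplacian matrix $\mathcal{L}$, describing a network of $n$ agents that executes the online spectrum estimation algorithm described in the context, so that the state of the network evolves according to $$\begin{bmatrix}\dot x(t)\\ \dot z(t)\end{bmatrix}=\begin{bmatrix}\mathbf{0}_{n\times n}& I+\mathcal{L}\\ -I-\mathcal{L}&\mathbf{0}_{n\times n}\end{bmatrix}\begin{bmatrix}x(t)\\ z(t)\end{bmatrix},\qquad x(t),z(t)\in\mathbb{R}^n.$$ Let the initial conditions of this system be not orthogonal to any eigenvector of the matrix $\mathcal{L}$. Let $i\in V$ and let $C=[0,\dots,1,\dots,0]$ be the $1\times n$ row vector that is zero everywhere except for the $i$-th element, which equals $1$. If the observability matrix $\mathcal{O}(\mathcal{L},C)$ is full rank, then agent $i$ can estimate all the eigenvalues of the Laplacian matrix $\mathcal{L}$.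
   Context: For an undirected graph on $V=\{1,\dots,n\}$, $\mathcal{N}_l$ is the set of neighbors of agent $l$ and $\Delta_l=|\mathcal{N}_l|$. The Laplacian $\mathcal{L}$ is the $n\times n$ matrix with diagonal entries $\Delta_p$ in position $(p,p)$, entry $-1$ in position $(p,q)$ if $q\in\mathcal{N}_p$, and $0$ otherwise. $I$ is the $n\times n$ identity matrix and $\mathbf{0}_{n\times n}$ the null matrix. $\mathcal{O}(\mathcal{L},C)$ is the observability matrix of the pair $(\mathcal{L},C)$, obtained by stacking $C,C\mathcal{L},\dots,C\mathcal{L}^{n-1}$. Online spectrum estimation algorithm: (1) each agent $l$ sets $t=0$ and chooses initial conditions $x_l(0),z_l(0)\in\{-1,1\}$ uniformly at random; (2) each agent $l$ simulates with its neighbors the local interaction rule $\dot x_l(t)=z_l(t)+\sum_{h\in\mathcal{N}_l}(z_l(t)-z_h(t))$, $\dot z_l(t)=-x_l(t)-\sum_{h\in\mathcal{N}_l}(x_l(t)-x_h(t))$, which in vector form is the system in the claim; (3) in a time window of length $T$, agent $l$ estimates the frequencies of the sinusoids of which its signal $x_l(t)$ is composed (by some frequency estimation method from signal processing or system identification); (4) the values of the estimated frequencies correspond to the eigenvalues of $\mathcal{L}$ shifted by $1$ and are given as output. *)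

theory Defs
  imports
    Complex_Main
    "Graph_Theory.Digraph_Component"
    "Graph_Theory.Pair_Digraph"
    "Jordan_Normal_Form.Char_Poly"
    "Jordan_Normal_Form.DL_Rank"
begin

text \<open>
  Undirected graphs are symmetric loop-free digraphs without parallel arcs (locale
  \<open>pair_graph\<close>). Agents are numbered \<open>0, \<dots>, n - 1\<close>, in accordance with the indexing of
  vectors and matrices.
\<close>

definition neighbors :: "'a pair_pre_digraph \<Rightarrow> 'a \<Rightarrow> 'a set" where
  "neighbors G l = {h. (l, h) \<in> parcs G}"

definition laplacian :: "nat \<Rightarrow> nat pair_pre_digraph \<Rightarrow> real mat" where
  "laplacian n G = mat n n (\<lambda>(p, q).
     if p = q then real (card (neighbors G p))
     else if q \<in> neighbors G p then -1
     else 0)"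

text \<open>
  For a \<open>p \<times> n\<close> output matrix \<open>C\<close>, row \<open>k * p + r\<close> of the observability matrix is
  row \<open>r\<close> of \<open>C A\<^sup>k\<close>, for \<open>k < n\<close> and \<open>r < p\<close>.
\<close>

definition observability_matrix :: "'a :: semiring_1 mat \<Rightarrow> 'a mat \<Rightarrow> 'a mat" where
  "observability_matrix A C = mat (dim_row A * dim_row C) (dim_row A)
     (\<lambda>(r, j). (C * A ^\<^sub>m (r div dim_row C)) $$ (r mod dim_row C, j))"

text \<open>The first argument of \<open>vec_space.rank\<close> is the length of the columns.\<close>

definition full_rank :: "'a :: field mat \<Rightarrow> bool" where
  "full_rank A \<longleftrightarrow> vec_space.rank (dim_row A) A = min (dim_row A) (dim_col A)"

definition system_matrix :: "nat \<Rightarrow> real mat \<Rightarrow> real mat" where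
  "system_matrix n L =
     four_block_mat (0\<^sub>m n n) (1\<^sub>m n + L) (- 1\<^sub>m n - L) (0\<^sub>m n n)"

text \<open>
  The vector type carries no topology, so the derivative is taken entrywise; at time \<open>0\<close>
  it is one-sided.
\<close>

definition network_trajectory ::
    "nat \<Rightarrow> real mat \<Rightarrow> (real \<Rightarrow> real vec) \<Rightarrow> (real \<Rightarrow> real vec) \<Rightarrow> bool" where
  "network_trajectory n L x z \<longleftrightarrow>
     (\<forall>t\<ge>0. x t \<in> carrier_vec n \<and> z t \<in> carrier_vec n \<and>
       (\<forall>k<n + n. ((\<lambda>s. (x s @\<^sub>v z s) $ k) has_real_derivative
           (system_matrix n L *\<^sub>v (x t @\<^sub>v z t)) $ k) (at t within {0..})))"

text \<open>
  On the time window \<open>W\<close> the signal \<open>y\<close> is a superposition of sinusoids whose distinct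
  frequencies are exactly the elements of \<open>\<Omega>\<close>: every one of them is present, with a
  positive amplitude.
\<close>

definition composed_of_sinusoids :: "real set \<Rightarrow> (real \<Rightarrow> real) \<Rightarrow> real set \<Rightarrow> bool" where
  "composed_of_sinusoids W y \<Omega> \<longleftrightarrow>
     finite \<Omega> \<and> (\<forall>\<omega>\<in>\<Omega>. 0 < \<omega>) \<and>
     (\<exists>A \<phi>. (\<forall>\<omega>\<in>\<Omega>. 0 < A \<omega>) \<and> (\<forall>t\<in>W. y t = (\<Sum>\<omega>\<in>\<Omega>. A \<omega> * sin (\<omega> * t + \<phi> \<omega>))))"

text \<open>
  An agent that observes \<open>y\<close> on the window \<open>W\<close>, extracts the frequencies of its sinusoids
  and shifts them by \<open>1\<close> obtains all eigenvalues of \<open>L\<close> and nothing else. The frequencies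
  must be determined by the observed data alone, hence the uniqueness requirement on \<open>\<Omega>\<close>.
\<close>

definition can_estimate_eigenvalues :: "real set \<Rightarrow> (real \<Rightarrow> real) \<Rightarrow> real mat \<Rightarrow> bool" where
  "can_estimate_eigenvalues W y L \<longleftrightarrow>
     (\<exists>\<Omega>. composed_of_sinusoids W y \<Omega> \<and>
          (\<forall>\<Omega>'. composed_of_sinusoids W y \<Omega>' \<longrightarrow> \<Omega>' = \<Omega>) \<and>
          (\<lambda>\<omega>. \<omega> - 1) ` \<Omega> = {\<mu>. eigenvalue L \<mu>})"

end

theory Submission
  imports Defs "Jordan_Normal_Form.Schur_Decomposition"
begin

text \<open>
  Projecting the trajectory on an eigenvector \<open>v\<close> of \<open>L\<close> with eigenvalue \<open>\<mu>\<close> gives a harmonic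
  oscillator of frequency \<open>1 + \<mu>\<close>, positive by Gershgorin, whose amplitude is nonzero by the
  assumption on the initial conditions. Observability at node \<open>i\<close> says that no eigenvector
  vanishes at \<open>i\<close>; hence the eigenvalues are simple and every eigenvector enters the expansion
  of the \<open>i\<close>-th unit vector with a nonzero coefficient. The signal of agent \<open>i\<close> is therefore a
  sum of sinusoids in which every frequency \<open>1 + \<mu>\<close> occurs, and by linear independence of
  sinusoids on an interval the frequencies are determined by the signal.
\<close>

subsection \<open>Sums of sinusoids\<close>

text \<open>Coefficients instead of amplitude and phase: for a fixed frequency the expression is
  linear in \<open>a\<close> and \<open>b\<close>, and differentiation only transforms these two
  numbers. At time 0 the value is \<open>a\<close>.\<close>

definition sinusoid :: "real \<Rightarrow> real \<Rightarrow> real \<Rightarrow> real \<Rightarrow> real" where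
  "sinusoid \<omega> a b t = a * cos (\<omega> * t) + b * sin (\<omega> * t)"

lemma sinusoid_has_derivative:
  "(sinusoid \<omega> a b has_real_derivative sinusoid \<omega> (\<omega> * b) (- \<omega> * a) t) (at t)"
  unfolding sinusoid_def
  by (auto intro!: derivative_eq_intros simp: algebra_simps)

lemma sinusoid_scale: "c * sinusoid \<omega> a b t = sinusoid \<omega> (c * a) (c * b) t"
  by (simp add: sinusoid_def algebra_simps)

lemma sinusoid_diff: "sinusoid \<omega> a b t - sinusoid \<omega> a' b' t = sinusoid \<omega> (a - a') (b - b') t"
  by (simp add: sinusoid_def algebra_simps)

lemma sin_phase_eq_sinusoid:
  "A * sin (\<omega> * t + \<phi>) = sinusoid \<omega> (A * sin \<phi>) (A * cos \<phi>) t"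
  by (simp add: sinusoid_def sin_add algebra_simps)

text \<open>Polar coordinates of the point \<open>(b, a)\<close>: the amplitude is its distance from
  the origin, the phase its angle. This leads back to the form with positive amplitudes that
  \<open>composed_of_sinusoids\<close> demands.\<close>

lemma sinusoid_amplitude_phase:
  assumes "a \<noteq> 0 \<or> b \<noteq> 0"
  obtains A \<phi> where "0 < A" "\<And>t. sinusoid \<omega> a b t = A * sin (\<omega> * t + \<phi>)"
proof -
  define A where "A = sqrt (a\<^sup>2 + b\<^sup>2)"
  have pos: "a\<^sup>2 + b\<^sup>2 > 0"
    using assms by (simp add: sum_power2_gt_zero_iff)
  hence A: "0 < A" "A\<^sup>2 = a\<^sup>2 + b\<^sup>2"
    by (auto simp: A_def)
  have "(b / A)\<^sup>2 + (a / A)\<^sup>2 = 1"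
    unfolding power_divide A(2) add_divide_distrib[symmetric] add.commute[of "b\<^sup>2"]
    using pos by (intro divide_self) linarith
  then obtain \<phi> where "b / A = cos \<phi>" "a / A = sin \<phi>"
    using sincos_total_2pi by metis
  hence "a = A * sin \<phi>" "b = A * cos \<phi>"
    using A by (auto simp: field_simps)
  thus ?thesis
    using that[of A \<phi>] A(1) by (simp add: sin_phase_eq_sinusoid)
qed

text \<open>Near \<open>t\<close> the function coincides with the zero function, and derivatives are
  unique. This passes the vanishing of a sum of sinusoids on to its derivatives.\<close>

lemma DERIV_zero_on_open_interval:
  fixes f :: "real \<Rightarrow> real"
  assumes "(f has_real_derivative D) (at t)" "t \<in> {u<..<v}" "\<And>s. s \<in> {u<..<v} \<Longrightarrow> f s = 0"
  shows "D = 0"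
proof -
  have "((\<lambda>_. 0) has_real_derivative D) (at t)"
    by (rule has_field_derivative_transform_within_open[OF assms(1), of "{u<..<v}"])
      (use assms in auto)
  thus ?thesis
    using DERIV_const DERIV_unique by blast
qed

text \<open>Induction on the set of frequencies: a differential operator eliminates one frequency,
  the induction hypothesis, applied to rescaled coefficients, disposes of the others, and the value
  and the derivative at one point then determine the eliminated one. Positivity excludes the pairs
  \<open>\<omega>\<close>, \<open>- \<omega>\<close> and the frequency 0, whose sine term is
  identically zero.\<close>

lemma sinusoids_linear_independent:
  assumes "finite \<Omega>" "\<forall>\<omega>\<in>\<Omega>. 0 < \<omega>" "u < v"
    and "\<forall>t\<in>{u<..<v}. (\<Sum>\<omega>\<in>\<Omega>. sinusoid \<omega> (a \<omega>) (b \<omega>) t) = 0"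
  shows "\<forall>\<omega>\<in>\<Omega>. a \<omega> = 0 \<and> b \<omega> = 0"
  using assms
proof (induction \<Omega> arbitrary: a b rule: finite_induct)
  case empty
  then show ?case by simp
next
  case (insert \<nu> \<Omega>)
  let ?f = "\<lambda>a b t. \<Sum>\<omega>\<in>insert \<nu> \<Omega>. sinusoid \<omega> (a \<omega>) (b \<omega>) t"
  have deriv: "(?f a b has_real_derivative ?f (\<lambda>\<omega>. \<omega> * b \<omega>) (\<lambda>\<omega>. - \<omega> * a \<omega>) t) (at t)" for a b t
    by (intro DERIV_sum sinusoid_has_derivative)
  have zero: "?f a b t = 0" if "t \<in> {u<..<v}" for t
    using insert.prems that by blast
  have zero1: "?f (\<lambda>\<omega>. \<omega> * b \<omega>) (\<lambda>\<omega>. - \<omega> * a \<omega>) t = 0" if "t \<in> {u<..<v}" for t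
    using DERIV_zero_on_open_interval[OF deriv that zero] .
  have zero2: "?f (\<lambda>\<omega>. \<omega> * (- \<omega> * a \<omega>)) (\<lambda>\<omega>. - \<omega> * (\<omega> * b \<omega>)) t = 0" if "t \<in> {u<..<v}" for t
    using DERIV_zero_on_open_interval[OF deriv that zero1] .
  \<comment> \<open>the operator \<open>f'' + \<nu>\<^sup>2 f\<close> kills the frequency \<open>\<nu>\<close> and rescales the others\<close>
  have "(\<Sum>\<omega>\<in>\<Omega>. sinusoid \<omega> ((\<nu>\<^sup>2 - \<omega>\<^sup>2) * a \<omega>) ((\<nu>\<^sup>2 - \<omega>\<^sup>2) * b \<omega>) t) = 0"
    if t: "t \<in> {u<..<v}" for t
  proof -
    have "0 = ?f (\<lambda>\<omega>. \<omega> * (- \<omega> * a \<omega>)) (\<lambda>\<omega>. - \<omega> * (\<omega> * b \<omega>)) t + \<nu>\<^sup>2 * ?f a b t"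
      using zero[OF t] zero2[OF t] by simp
    also have "\<dots> = ?f (\<lambda>\<omega>. (\<nu>\<^sup>2 - \<omega>\<^sup>2) * a \<omega>) (\<lambda>\<omega>. (\<nu>\<^sup>2 - \<omega>\<^sup>2) * b \<omega>) t"
      unfolding sum_distrib_left sum.distrib[symmetric]
      by (intro sum.cong) (auto simp: sinusoid_def algebra_simps power2_eq_square)
    also have "\<dots> = (\<Sum>\<omega>\<in>\<Omega>. sinusoid \<omega> ((\<nu>\<^sup>2 - \<omega>\<^sup>2) * a \<omega>) ((\<nu>\<^sup>2 - \<omega>\<^sup>2) * b \<omega>) t)"
      using insert.hyps by (simp add: sinusoid_def)
    finally show ?thesis by simp
  qed
  hence "\<forall>\<omega>\<in>\<Omega>. (\<nu>\<^sup>2 - \<omega>\<^sup>2) * a \<omega> = 0 \<and> (\<nu>\<^sup>2 - \<omega>\<^sup>2) * b \<omega> = 0"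
    using insert.IH[of "\<lambda>\<omega>. (\<nu>\<^sup>2 - \<omega>\<^sup>2) * a \<omega>" "\<lambda>\<omega>. (\<nu>\<^sup>2 - \<omega>\<^sup>2) * b \<omega>"] insert.prems
    by blast
  \<comment> \<open>Distinct positive numbers have distinct squares, so the rescaling factors can be
    cancelled.\<close>
  moreover have "\<nu>\<^sup>2 - \<omega>\<^sup>2 \<noteq> 0" if "\<omega> \<in> \<Omega>" for \<omega>
    using that insert.hyps(2) insert.prems(1) power2_eq_iff_nonneg[of \<nu> \<omega>] by force
  ultimately have rest: "\<forall>\<omega>\<in>\<Omega>. a \<omega> = 0 \<and> b \<omega> = 0"
    by auto
  \<comment> \<open>Any point of the interval serves; the midpoint is one.\<close>
  define t where "t = (u + v) / 2"
  have t: "t \<in> {u<..<v}"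
    using \<open>u < v\<close> by (simp add: t_def)
  have "\<nu> > 0"
    using insert.prems by auto
  have "(\<Sum>\<omega>\<in>\<Omega>. sinusoid \<omega> (a \<omega>) (b \<omega>) t) = 0"
    "(\<Sum>\<omega>\<in>\<Omega>. sinusoid \<omega> (\<omega> * b \<omega>) (- \<omega> * a \<omega>) t) = 0"
    using rest by (auto intro!: sum.neutral simp: sinusoid_def)
  hence "sinusoid \<nu> (a \<nu>) (b \<nu>) t = 0" "sinusoid \<nu> (\<nu> * b \<nu>) (- \<nu> * a \<nu>) t = 0"
    using zero[OF t] zero1[OF t] insert.hyps by auto
  hence eqs: "a \<nu> * cos (\<nu> * t) + b \<nu> * sin (\<nu> * t) = 0"
    "b \<nu> * cos (\<nu> * t) - a \<nu> * sin (\<nu> * t) = 0"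
    using \<open>\<nu> > 0\<close> by (auto simp: sinusoid_def)
  \<comment> \<open>The left-hand sides of \<open>eqs\<close> are the coordinates of
    \<open>(a \<nu>, b \<nu>)\<close> after a rotation by the angle \<open>\<nu> * t\<close>, which
    preserves the norm.\<close>
  have "(a \<nu>)\<^sup>2 + (b \<nu>)\<^sup>2 = ((a \<nu>)\<^sup>2 + (b \<nu>)\<^sup>2) * ((sin (\<nu> * t))\<^sup>2 + (cos (\<nu> * t))\<^sup>2)"
    by simp
  also have "\<dots> = (a \<nu> * cos (\<nu> * t) + b \<nu> * sin (\<nu> * t))\<^sup>2 + (b \<nu> * cos (\<nu> * t) - a \<nu> * sin (\<nu> * t))\<^sup>2"
    by (simp only: power2_eq_square algebra_simps)
  finally have "(a \<nu>)\<^sup>2 + (b \<nu>)\<^sup>2 = 0"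
    using eqs by simp
  with rest show ?case
    by (auto simp: sum_power2_eq_zero_iff)
qed

text \<open>The difference of the two representations is a vanishing sum over the union of the
  frequency sets, so the coefficients agree at every frequency. One that occurs in
  \<open>\<Omega>\<close> has positive amplitude and cannot be missing from
  \<open>\<Omega>'\<close>.\<close>

lemma composed_of_sinusoids_subset:
  assumes "composed_of_sinusoids {u..v} y \<Omega>" "composed_of_sinusoids {u..v} y \<Omega>'" "u < v"
  shows "\<Omega> \<subseteq> \<Omega>'"
proof
  fix \<nu> assume \<nu>: "\<nu> \<in> \<Omega>"
  obtain A \<phi> where fin: "finite \<Omega>" "\<forall>\<omega>\<in>\<Omega>. 0 < \<omega>" and A: "\<forall>\<omega>\<in>\<Omega>. 0 < A \<omega>"
    and y: "\<forall>t\<in>{u..v}. y t = (\<Sum>\<omega>\<in>\<Omega>. A \<omega> * sin (\<omega> * t + \<phi> \<omega>))"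
    using assms(1) unfolding composed_of_sinusoids_def by blast
  obtain A' \<phi>' where fin': "finite \<Omega>'" "\<forall>\<omega>\<in>\<Omega>'. 0 < \<omega>"
    and y': "\<forall>t\<in>{u..v}. y t = (\<Sum>\<omega>\<in>\<Omega>'. A' \<omega> * sin (\<omega> * t + \<phi>' \<omega>))"
    using assms(2) unfolding composed_of_sinusoids_def by blast
  \<comment> \<open>Amplitudes are extended by 0, so that both sums can range over
    \<open>\<Omega> \<union> \<Omega>'\<close>.\<close>
  define B where "B = (\<lambda>\<omega>. if \<omega> \<in> \<Omega> then A \<omega> else 0)"
  define B' where "B' = (\<lambda>\<omega>. if \<omega> \<in> \<Omega>' then A' \<omega> else 0)"
  have "(\<Sum>\<omega>\<in>\<Omega> \<union> \<Omega>'. sinusoid \<omega> (B \<omega> * sin (\<phi> \<omega>) - B' \<omega> * sin (\<phi>' \<omega>))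
      (B \<omega> * cos (\<phi> \<omega>) - B' \<omega> * cos (\<phi>' \<omega>)) t) = 0" if "t \<in> {u<..<v}" for t
  proof -
    have "(\<Sum>\<omega>\<in>\<Omega> \<union> \<Omega>'. B \<omega> * sin (\<omega> * t + \<phi> \<omega>)) = y t"
      using y that fin fin' by (auto simp: B_def intro!: sum.mono_neutral_cong_right)
    moreover have "(\<Sum>\<omega>\<in>\<Omega> \<union> \<Omega>'. B' \<omega> * sin (\<omega> * t + \<phi>' \<omega>)) = y t"
      using y' that fin fin' by (auto simp: B'_def intro!: sum.mono_neutral_cong_right)
    ultimately have "(\<Sum>\<omega>\<in>\<Omega> \<union> \<Omega>'. B \<omega> * sin (\<omega> * t + \<phi> \<omega>) - B' \<omega> * sin (\<omega> * t + \<phi>' \<omega>)) = 0"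
      by (simp add: sum_subtractf)
    thus ?thesis
      by (simp add: sin_phase_eq_sinusoid sinusoid_diff)
  qed
  hence "\<forall>\<omega>\<in>\<Omega> \<union> \<Omega>'. B \<omega> * sin (\<phi> \<omega>) - B' \<omega> * sin (\<phi>' \<omega>) = 0 \<and>
      B \<omega> * cos (\<phi> \<omega>) - B' \<omega> * cos (\<phi>' \<omega>) = 0"
    by (intro sinusoids_linear_independent) (use fin fin' \<open>u < v\<close> in auto)
  hence eqs: "B \<nu> * sin (\<phi> \<nu>) = B' \<nu> * sin (\<phi>' \<nu>)" "B \<nu> * cos (\<phi> \<nu>) = B' \<nu> * cos (\<phi>' \<nu>)"
    using \<nu> by auto
  show "\<nu> \<in> \<Omega>'"
  proof (rule ccontr)
    assume "\<nu> \<notin> \<Omega>'"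
    \<comment> \<open>Here \<open>B' \<nu>\<close> is the default value 0 while
      \<open>B \<nu>\<close> is positive.\<close>
    hence "sin (\<phi> \<nu>) = 0" "cos (\<phi> \<nu>) = 0"
      using eqs \<nu> A by (auto simp: B_def B'_def)
    thus False
      using sin_cos_squared_add[of "\<phi> \<nu>"] by simp
  qed
qed

section \<open>The harmonic oscillator\<close>

text \<open>In a frame rotating with angular velocity \<open>\<omega>\<close> the point
  \<open>(f t, g t)\<close> stands still. Its two coordinates there are first integrals, and
  rotating back gives the solution.\<close>

lemma harmonic_oscillator_solution:
  fixes f g :: "real \<Rightarrow> real"
  assumes f: "\<And>t. t \<ge> 0 \<Longrightarrow> (f has_real_derivative \<omega> * g t) (at t within {0..})"
    and g: "\<And>t. t \<ge> 0 \<Longrightarrow> (g has_real_derivative - \<omega> * f t) (at t within {0..})"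
    and "t \<ge> 0"
  shows "f t = sinusoid \<omega> (f 0) (g 0) t"
proof -
  \<comment> \<open>The hypothesis is one-sided at 0, but continuity on the closed interval and an
    ordinary derivative in its interior suffice for constancy.\<close>
  have const: "h t = h 0"
    if h: "\<And>t. t \<ge> 0 \<Longrightarrow> (h has_real_derivative 0) (at t within {0..})" for h :: "real \<Rightarrow> real"
  proof (cases "t = 0")
    case False
    show ?thesis
    proof (rule DERIV_isconst_end[of 0 t h])
      show "0 < t" using False \<open>t \<ge> 0\<close> by simp
      have "continuous_on {0..} h"
        using DERIV_continuous[OF h] by (auto simp: continuous_on_eq_continuous_within)
      thus "continuous_on {0..t} h"
        by (rule continuous_on_subset) auto
      show "DERIV h s :> 0" if "0 < s" for s
        using h[of s] that at_within_open_subset[of s "{0<..}" "{0..}"]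
        by (auto simp: subset_eq)
    qed
  qed simp
  \<comment> \<open>The values at 0 are left unsimplified so that both sides are instances of one
    function of time, as \<open>const\<close> requires.\<close>
  have u: "f t * cos (\<omega> * t) - g t * sin (\<omega> * t) = f 0 * cos (\<omega> * 0) - g 0 * sin (\<omega> * 0)"
    by (rule const) (auto intro!: derivative_eq_intros f g simp: algebra_simps)
  have v: "f t * sin (\<omega> * t) + g t * cos (\<omega> * t) = f 0 * sin (\<omega> * 0) + g 0 * cos (\<omega> * 0)"
    by (rule const) (auto intro!: derivative_eq_intros f g simp: algebra_simps)
  have "f t = f t * ((sin (\<omega> * t))\<^sup>2 + (cos (\<omega> * t))\<^sup>2)"
    by simp
  also have "\<dots> = (f t * cos (\<omega> * t) - g t * sin (\<omega> * t)) * cos (\<omega> * t) +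
      (f t * sin (\<omega> * t) + g t * cos (\<omega> * t)) * sin (\<omega> * t)"
    by (simp only: power2_eq_square algebra_simps)
  finally show ?thesis
    unfolding u v by (simp add: sinusoid_def)
qed

subsection \<open>Eigenvectors of symmetric matrices and observability\<close>

lemma symmetric_mat_scalar_prod:
  fixes A :: "'a :: comm_semiring_0 mat"
  assumes "A \<in> carrier_mat n n" "transpose_mat A = A" "u \<in> carrier_vec n" "v \<in> carrier_vec n"
  shows "(A *\<^sub>v u) \<bullet> v = u \<bullet> (A *\<^sub>v v)"
  using transpose_vec_mult_scalar[of A n n v u] assms by simp

lemma scalar_prod_self_nonneg: "0 \<le> v \<bullet> (v :: real vec)"
  by (auto simp: scalar_prod_def intro: sum_nonneg)

lemma scalar_prod_self_eq_0:
  fixes v :: "real vec"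
  assumes "v \<in> carrier_vec n"
  shows "v \<bullet> v = 0 \<longleftrightarrow> v = 0\<^sub>v n"
proof -
  have "conjugate v = v"
    by (intro eq_vecI) auto
  thus ?thesis
    using conjugate_square_eq_0_vec[OF assms] by simp
qed

section \<open>Reality of the spectrum of a symmetric matrix\<close>

text \<open>Split a complex eigenvector into its real part \<open>p\<close> and imaginary part
  \<open>q\<close>. Comparing \<open>(A *\<^sub>v p) \<bullet> q\<close> with
  \<open>p \<bullet> (A *\<^sub>v q)\<close> leaves
  \<open>Im k * (p \<bullet> p + q \<bullet> q) = 0\<close>, whose second factor is
  positive.\<close>

lemma symmetric_real_mat_eigenvalue_real:
  fixes A :: "real mat"
  assumes A: "A \<in> carrier_mat n n" and sym: "transpose_mat A = A"
    and "eigenvalue (map_mat complex_of_real A) k"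
  shows "Im k = 0"
proof -
  obtain w where w: "w \<in> carrier_vec n" "w \<noteq> 0\<^sub>v n"
    and Aw: "map_mat complex_of_real A *\<^sub>v w = k \<cdot>\<^sub>v w"
    using assms unfolding eigenvalue_def eigenvector_def by auto
  define p where "p = map_vec Re w"
  define q where "q = map_vec Im w"
  have carrier: "p \<in> carrier_vec n" "q \<in> carrier_vec n"
    using w by (auto simp: p_def q_def)
  have Aw': "(\<Sum>j<n. of_real (A $$ (i, j)) * w $ j) = k * w $ i" if "i < n" for i
    using arg_cong[OF Aw, of "\<lambda>v. v $ i"] that A w
    by (auto simp: scalar_prod_def atLeast0LessThan)
  have Ap: "A *\<^sub>v p = Re k \<cdot>\<^sub>v p - Im k \<cdot>\<^sub>v q"
  proof (intro eq_vecI)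
    fix i assume "i < dim_vec (Re k \<cdot>\<^sub>v p - Im k \<cdot>\<^sub>v q)"
    hence i: "i < n" using carrier by auto
    show "(A *\<^sub>v p) $ i = (Re k \<cdot>\<^sub>v p - Im k \<cdot>\<^sub>v q) $ i"
      using arg_cong[OF Aw'[OF i], of Re] i A w
      by (auto simp: scalar_prod_def atLeast0LessThan p_def q_def)
  qed (use A carrier in auto)
  have Aq: "A *\<^sub>v q = Re k \<cdot>\<^sub>v q + Im k \<cdot>\<^sub>v p"
  proof (intro eq_vecI)
    fix i assume "i < dim_vec (Re k \<cdot>\<^sub>v q + Im k \<cdot>\<^sub>v p)"
    hence i: "i < n" using carrier by auto
    show "(A *\<^sub>v q) $ i = (Re k \<cdot>\<^sub>v q + Im k \<cdot>\<^sub>v p) $ i"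
      using arg_cong[OF Aw'[OF i], of Im] i A w
      by (auto simp: scalar_prod_def atLeast0LessThan p_def q_def)
  qed (use A carrier in auto)
  have "(A *\<^sub>v p) \<bullet> q = p \<bullet> (A *\<^sub>v q)"
    by (rule symmetric_mat_scalar_prod[OF A sym carrier])
  hence "Im k * (p \<bullet> p + q \<bullet> q) = 0"
    using carrier
    by (simp add: Ap Aq minus_scalar_prod_distrib[of _ n] scalar_prod_add_distrib[of _ n]
        smult_scalar_prod_distrib[of _ n] scalar_prod_smult_distrib[of _ n] algebra_simps)
  moreover have "p \<bullet> p + q \<bullet> q \<noteq> 0"
  proof
    assume "p \<bullet> p + q \<bullet> q = 0"
    hence "p \<bullet> p = 0" "q \<bullet> q = 0"
      using scalar_prod_self_nonneg[of p] scalar_prod_self_nonneg[of q] by linarith+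
    hence zero: "p = 0\<^sub>v n" "q = 0\<^sub>v n"
      using scalar_prod_self_eq_0 carrier by auto
    have "w $ i = 0" if "i < n" for i
      using arg_cong[OF zero(1), of "\<lambda>v. v $ i"] arg_cong[OF zero(2), of "\<lambda>v. v $ i"] that w
      by (auto simp: p_def q_def complex_eq_iff)
    hence "w = 0\<^sub>v n"
      using w(1) by (intro eq_vecI) auto
    with w show False by simp
  qed
  ultimately show ?thesis by simp
qed

text \<open>Over the complex numbers the polynomial splits, and its roots are eigenvalues, hence
  real. The splitting is what a Schur decomposition over the reals requires.\<close>

lemma symmetric_real_char_poly_splits:
  fixes A :: "real mat"
  assumes A: "A \<in> carrier_mat n n" and sym: "transpose_mat A = A"
  obtains as where "char_poly A = (\<Prod>a\<leftarrow>as. [:- a, 1:])"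
proof -
  let ?A = "map_mat complex_of_real A"
  have cA: "?A \<in> carrier_mat n n"
    using A by simp
  obtain as where as: "char_poly ?A = (\<Prod>a\<leftarrow>as. [:- a, 1:])"
    using char_poly_factorized[OF cA] by blast
  have real: "of_real (Re a) = a" if "a \<in> set as" for a
  proof -
    have "poly (char_poly ?A) a = 0"
      unfolding as poly_prod_list using that by (auto simp: prod_list_zero_iff image_iff)
    hence "eigenvalue ?A a"
      using eigenvalue_root_char_poly[OF cA] by blast
    thus ?thesis
      using symmetric_real_mat_eigenvalue_real[OF A sym] by (simp add: complex_eq_iff)
  qed
  have "map_poly complex_of_real (\<Prod>a\<leftarrow>map Re as. [:- a, 1:]) = (\<Prod>a\<leftarrow>as. [:- a, 1:])"
    using real
  proof (induction as)
    case (Cons a as)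
    interpret map_poly_comm_ring_hom complex_of_real ..
    show ?case
      using Cons by (simp add: hom_mult del: mult_pCons_left)
  qed simp
  also have "\<dots> = map_poly complex_of_real (char_poly A)"
    unfolding as[symmetric] by (rule of_real_hom.char_poly_hom[OF A])
  \<comment> \<open>The embedding of the reals is injective, so the factorization descends
    coefficient by coefficient.\<close>
  finally have "char_poly A = (\<Prod>a\<leftarrow>map Re as. [:- a, 1:])"
    by (simp add: poly_eq_iff coeff_map_poly)
  thus ?thesis
    by (rule that)
qed

section \<open>Completeness of the eigenvectors\<close>

text \<open>\<open>P\<close> plays the part of membership in an invariant subspace. Starting from
  \<open>w\<close>, subtract successive diagonal entries of the Schur form from \<open>A\<close> and
  apply the result, from the last entry to the first. Eventually a nonzero vector is sent to 0; it
  is an eigenvector, and it has inherited \<open>P\<close>.\<close>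

lemma invariant_predicate_has_eigenvector:
  fixes A :: "'a :: conjugatable_ordered_field mat"
  assumes A: "A \<in> carrier_mat n n" and splits: "char_poly A = (\<Prod>a\<leftarrow>as. [:- a, 1:])"
    and invariant: "\<And>w a. w \<in> carrier_vec n \<Longrightarrow> P w \<Longrightarrow> P (A *\<^sub>v w - a \<cdot>\<^sub>v w)"
    and w: "w \<in> carrier_vec n" "w \<noteq> 0\<^sub>v n" "P w"
  shows "\<exists>u k. eigenvector A u k \<and> P u"
proof -
  obtain B U V where "schur_decomposition A as = (B, U, V)"
    by (metis prod_cases3)
  from schur_decomposition[OF A splits this]
  have sim: "similar_mat_wit A B U V" and tri: "upper_triangular B"
    by auto
  note UV = similar_mat_witD2[OF A sim]
  \<comment> \<open>\<open>V *\<^sub>v w\<close> lists the coordinates of \<open>w\<close> in the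
    basis of columns of \<open>U\<close>, and in these coordinates \<open>A\<close> acts as the
    triangular matrix \<open>B\<close>.\<close>
  have VA: "V * A = B * V"
    using UV by (simp add: assoc_mult_mat[of _ n n _ n _ n] flip: assoc_mult_mat[of V n n U n _ n])
  have V_inj: "v = 0\<^sub>v n" if "v \<in> carrier_vec n" "V *\<^sub>v v = 0\<^sub>v n" for v
  proof -
    have "v = (U * V) *\<^sub>v v"
      using UV that by simp
    also have "\<dots> = U *\<^sub>v (V *\<^sub>v v)"
      using UV that by (intro assoc_mult_mat_vec)
    finally show ?thesis
      using UV that by (intro eq_vecI) auto
  qed
  \<comment> \<open>\<open>A - B $$ (m, m)\<close> lowers the index of the last nonzero Schur coordinate\<close>
  have "\<exists>u k. eigenvector A u k \<and> P u"
    if "w \<in> carrier_vec n" "w \<noteq> 0\<^sub>v n" "P w" "m \<le> n" "\<forall>j. m \<le> j \<and> j < n \<longrightarrow> (V *\<^sub>v w) $ j = 0"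
    for m w
    using that
  proof (induction m arbitrary: w)
    case 0
    have "V *\<^sub>v w = 0\<^sub>v n"
      using 0 UV by (intro eq_vecI) auto
    with V_inj 0 show ?case by blast
  next
    case (Suc m)
    define k where "k = B $$ (m, m)"
    define w' where "w' = A *\<^sub>v w - k \<cdot>\<^sub>v w"
    have w': "w' \<in> carrier_vec n" "P w'"
      using Suc.prems A invariant by (auto simp: w'_def)
    show ?case
    proof (cases "w' = 0\<^sub>v n")
      case True
      have "(A *\<^sub>v w) $ i = (k \<cdot>\<^sub>v w) $ i" if "i < n" for i
        using arg_cong[OF True, of "\<lambda>v. v $ i"] that A Suc.prems(1) by (simp add: w'_def)
      hence "A *\<^sub>v w = k \<cdot>\<^sub>v w"
        using A Suc.prems(1) by (intro eq_vecI) auto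
      thus ?thesis
        using Suc.prems A unfolding eigenvector_def by auto
    next
      case False
      define c where "c = V *\<^sub>v w"
      have c: "c \<in> carrier_vec n" "\<And>j. m < j \<Longrightarrow> j < n \<Longrightarrow> c $ j = 0"
        using Suc.prems UV by (auto simp: c_def)
      have "V *\<^sub>v w' = V *\<^sub>v (A *\<^sub>v w) - V *\<^sub>v (k \<cdot>\<^sub>v w)"
        unfolding w'_def using UV(7) mult_mat_vec_carrier[OF A Suc.prems(1)] Suc.prems(1)
        by (intro mult_minus_distrib_mat_vec) auto
      also have "V *\<^sub>v (A *\<^sub>v w) = B *\<^sub>v c"
        using UV A Suc.prems(1) VA unfolding c_def
        by (metis assoc_mult_mat_vec)
      also have "V *\<^sub>v (k \<cdot>\<^sub>v w) = k \<cdot>\<^sub>v c"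
        using UV Suc.prems(1) unfolding c_def by (intro mult_mat_vec)
      finally have Vw': "V *\<^sub>v w' = B *\<^sub>v c - k \<cdot>\<^sub>v c" .
      have "(V *\<^sub>v w') $ j = 0" if j: "m \<le> j" "j < n" for j
      proof -
        have "(B *\<^sub>v c) $ j = (\<Sum>l\<in>{0..<n}. B $$ (j, l) * c $ l)"
          using UV c j by (simp add: scalar_prod_def)
        \<comment> \<open>Entries of \<open>B\<close> left of the diagonal are 0, and so are the
          coordinates of \<open>c\<close> beyond \<open>m\<close>. As \<open>m \<le> j\<close>, only
          the index \<open>m\<close> survives.\<close>
        also have "\<dots> = (\<Sum>l\<in>{m}. B $$ (j, l) * c $ l)"
        proof (intro sum.mono_neutral_right ballI)
          fix l assume l: "l \<in> {0..<n} - {m}"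
          show "B $$ (j, l) * c $ l = 0"
          proof (cases "l < m")
            case True
            thus ?thesis
              using tri UV j by (simp add: upper_triangularD)
          next
            case False
            thus ?thesis
              using c l by simp
          qed
        qed (use Suc.prems in auto)
        \<comment> \<open>For \<open>j > m\<close> both sides are 0: the left one by triangularity,
          the right one because \<open>c $ j = 0\<close>.\<close>
        also have "\<dots> = k * c $ j"
        proof (cases "j = m")
          case True
          thus ?thesis by (simp add: k_def)
        next
          case False
          thus ?thesis
            using tri UV j c by (simp add: upper_triangularD)
        qed
        finally show ?thesis
          using Vw' c UV j by simp
      qed
      with Suc.IH[OF w'(1) False w'(2)] Suc.prems show ?thesis
        by simp
    qed
  qed
  from this[OF w order_refl] show ?thesis
    by (metis not_le)
qed

text \<open>By symmetry the orthogonal complement of all eigenvectors is invariant. Were it nonzero,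
  it would contain an eigenvector, which would be orthogonal to itself.\<close>

lemma orthogonal_to_all_eigenvectors_imp_zero:
  fixes A :: "real mat"
  assumes A: "A \<in> carrier_mat n n" and sym: "transpose_mat A = A"
    and w: "w \<in> carrier_vec n" and orth: "\<And>v k. eigenvector A v k \<Longrightarrow> w \<bullet> v = 0"
  shows "w = 0\<^sub>v n"
proof (rule ccontr)
  assume "w \<noteq> 0\<^sub>v n"
  define P where "P w \<longleftrightarrow> (\<forall>v k. eigenvector A v k \<longrightarrow> w \<bullet> v = 0)" for w
  obtain as where as: "char_poly A = (\<Prod>a\<leftarrow>as. [:- a, 1:])"
    using symmetric_real_char_poly_splits[OF A sym] .
  have "P (A *\<^sub>v u - a \<cdot>\<^sub>v u)" if u: "u \<in> carrier_vec n" "P u" for u a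
    unfolding P_def
  proof (intro allI impI)
    fix v k assume v: "eigenvector A v k"
    hence v': "v \<in> carrier_vec n" "A *\<^sub>v v = k \<cdot>\<^sub>v v"
      using A by (auto simp: eigenvector_def)
    have "u \<bullet> v = 0"
      using u v by (auto simp: P_def)
    thus "(A *\<^sub>v u - a \<cdot>\<^sub>v u) \<bullet> v = 0"
      using u v' A symmetric_mat_scalar_prod[OF A sym u(1) v'(1)]
      by (simp add: minus_scalar_prod_distrib[of _ n] smult_scalar_prod_distrib[of _ n]
          scalar_prod_smult_distrib[of _ n])
  qed
  moreover have "P w"
    using orth by (auto simp: P_def)
  ultimately obtain u k where u: "eigenvector A u k" "P u"
    using invariant_predicate_has_eigenvector[OF A as, of P w] w \<open>w \<noteq> 0\<^sub>v n\<close> by blast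
  hence "u \<bullet> u = 0"
    by (auto simp: P_def)
  thus False
    using u A scalar_prod_self_eq_0[of u n] by (auto simp: eigenvector_def)
qed

lemma finite_eigenvalues:
  fixes A :: "'a :: field mat"
  assumes "A \<in> carrier_mat n n"
  shows "finite {k. eigenvalue A k}"
proof -
  have "char_poly A \<noteq> 0"
    using degree_monic_char_poly[OF assms] by auto
  thus ?thesis
    using eigenvalue_root_char_poly[OF assms] poly_roots_finite by simp
qed

section \<open>Observability from a single node\<close>

lemma mult_mat_of_unit_row:
  assumes "A \<in> carrier_mat n m" "i < n" "j < m"
  shows "(mat 1 n (\<lambda>(r, j). if j = i then 1 else 0) * A) $$ (0, j) = (A $$ (i, j) :: 'a :: semiring_1)"
proof -
  have "(mat 1 n (\<lambda>(r, j). if j = i then 1 else 0) * A) $$ (0, j) =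
      (\<Sum>k\<in>{0..<n}. (if k = i then 1 else 0) * A $$ (k, j))"
    using assms by (simp add: scalar_prod_def)
  also have "\<dots> = (\<Sum>k\<in>{0..<n}. if k = i then A $$ (k, j) else 0)"
    by (intro sum.cong) auto
  finally show ?thesis
    using assms by (simp add: sum.delta)
qed

text \<open>One direction of the Popov-Belevitch-Hautus test: if \<open>v $ i = 0\<close>, then
  every row of the observability matrix annihilates \<open>v\<close>, since its product with
  \<open>v\<close> is a power of \<open>k\<close> times \<open>v $ i\<close>.\<close>

lemma observable_eigenvector_nonzero:
  fixes A :: "'a :: field mat"
  assumes A: "A \<in> carrier_mat n n" and i: "i < n"
    and obs: "full_rank (observability_matrix A (mat 1 n (\<lambda>(r, j). if j = i then 1 else 0)))"
    and v: "eigenvector A v k"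
  shows "v $ i \<noteq> 0"
proof
  assume zero: "v $ i = 0"
  let ?C = "mat 1 n (\<lambda>(r, j). if j = i then 1 else 0) :: 'a mat"
  let ?O = "observability_matrix A ?C"
  have v': "v \<in> carrier_vec n" "v \<noteq> 0\<^sub>v n"
    using v A by (auto simp: eigenvector_def)
  \<comment> \<open>With a single output the observability matrix is square, so full rank means a
    nonzero determinant.\<close>
  have O: "?O \<in> carrier_mat n n"
    unfolding observability_matrix_def by (rule carrier_matI) (use A in simp_all)
  have "(?O *\<^sub>v v) $ r = 0" if r: "r < n" for r
  proof -
    have "(?O *\<^sub>v v) $ r = (\<Sum>j\<in>{0..<n}. (?C * A ^\<^sub>m r) $$ (0, j) * v $ j)"
      using r A v' by (simp add: observability_matrix_def scalar_prod_def)
    also have "\<dots> = (\<Sum>j\<in>{0..<n}. (A ^\<^sub>m r) $$ (i, j) * v $ j)"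
      using mult_mat_of_unit_row[of "A ^\<^sub>m r" n n i] A i by (intro sum.cong) auto
    also have "\<dots> = (A ^\<^sub>m r *\<^sub>v v) $ i"
      using A i v' by (simp add: scalar_prod_def)
    also have "\<dots> = 0"
      using eigenvector_pow[OF A v] zero i v' by simp
    finally show ?thesis .
  qed
  hence "?O *\<^sub>v v = 0\<^sub>v n"
    using O by (intro eq_vecI) auto
  hence "det ?O = 0"
    using det_0_iff_vec_prod_zero_field[OF O] v' by blast
  hence "vec_space.rank n ?O \<noteq> n"
    using vec_space.det_rank_iff[OF O] by blast
  thus False
    using obs O by (auto simp: full_rank_def)
qed

text \<open>
  Every eigenspace is a line here: some combination of two eigenvectors for the same
  eigenvalue vanishes at \<open>i\<close>.
\<close>

lemma unit_vector_eigenvector_expansion: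
  fixes A :: "real mat"
  assumes A: "A \<in> carrier_mat n n" and sym: "transpose_mat A = A" and i: "i < n"
    and nonzero: "\<And>u k. eigenvector A u k \<Longrightarrow> u $ i \<noteq> 0"
    and v: "\<And>k. eigenvalue A k \<Longrightarrow> eigenvector A (v k) k \<and> v k $ i = 1"
    and j: "j < n"
  shows "(\<Sum>k\<in>{k. eigenvalue A k}. v k $ j / (v k \<bullet> v k)) = (if j = i then 1 else 0)"
proof -
  let ?S = "{k. eigenvalue A k}"
  note fin = finite_eigenvalues[OF A]
  have v_carrier: "v k \<in> carrier_vec n" "v k \<noteq> 0\<^sub>v n" "A *\<^sub>v v k = k \<cdot>\<^sub>v v k" if "k \<in> ?S" for k
    using v[of k] that A by (auto simp: eigenvector_def)
  have orth: "v k \<bullet> v l = 0" if "k \<in> ?S" "l \<in> ?S" "k \<noteq> l" for k l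
  proof -
    have "k * (v k \<bullet> v l) = l * (v k \<bullet> v l)"
      using symmetric_mat_scalar_prod[OF A sym v_carrier(1)[OF that(1)] v_carrier(1)[OF that(2)]]
        v_carrier[OF that(1)] v_carrier[OF that(2)]
      by (simp add: smult_scalar_prod_distrib[of _ n] scalar_prod_smult_distrib[of _ n])
    thus ?thesis
      using that by simp
  qed
  \<comment> \<open>\<open>w\<close> is the error of the expansion of the \<open>i\<close>-th unit
    vector. The coefficient of \<open>v k\<close> is \<open>1 / (v k \<bullet> v k)\<close> because
    \<open>v k $ i = 1\<close>. It remains to see that \<open>w\<close> is orthogonal to every
    eigenvector.\<close>
  define w where
    "w = vec n (\<lambda>j. (\<Sum>k\<in>?S. v k $ j / (v k \<bullet> v k)) - (if j = i then 1 else 0))"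
  have w: "w \<in> carrier_vec n"
    by (simp add: w_def)
  have w_dot: "w \<bullet> u = (\<Sum>k\<in>?S. (v k \<bullet> u) / (v k \<bullet> v k)) - u $ i" if u: "u \<in> carrier_vec n" for u
  proof -
    have "w \<bullet> u = (\<Sum>j\<in>{0..<n}. \<Sum>k\<in>?S. v k $ j * u $ j / (v k \<bullet> v k)) -
        (\<Sum>j\<in>{0..<n}. if j = i then u $ j else 0)"
      unfolding sum_subtractf[symmetric] scalar_prod_def[of w u]
      using u by (auto simp: w_def left_diff_distrib sum_distrib_right intro!: sum.cong)
    also have "(\<Sum>j\<in>{0..<n}. \<Sum>k\<in>?S. v k $ j * u $ j / (v k \<bullet> v k)) =
        (\<Sum>k\<in>?S. (v k \<bullet> u) / (v k \<bullet> v k))"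
      using u by (subst sum.swap) (simp add: scalar_prod_def[of _ u] sum_divide_distrib)
    finally show ?thesis
      using i by simp
  qed
  have "w \<bullet> u = 0" if u: "eigenvector A u l" for u l
  proof -
    have l: "l \<in> ?S"
      using u by (auto simp: eigenvalue_def)
    have u': "u \<in> carrier_vec n" "A *\<^sub>v u = l \<cdot>\<^sub>v u"
      using u A by (auto simp: eigenvector_def)
    have "u = u $ i \<cdot>\<^sub>v v l"
    proof -
      \<comment> \<open>\<open>?d\<close> satisfies the eigenvalue equation for \<open>l\<close> and
        vanishes at \<open>i\<close>; by \<open>nonzero\<close> it is no eigenvector, hence it is
        0.\<close>
      let ?d = "u - u $ i \<cdot>\<^sub>v v l"
      have "A *\<^sub>v ?d = l \<cdot>\<^sub>v ?d"
        using A u' v_carrier[OF l]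
        by (auto simp: mult_minus_distrib_mat_vec[of _ n n] mult_mat_vec[of _ n n] right_diff_distrib
            intro!: eq_vecI)
      moreover have "?d $ i = 0"
        using v[of l] l i u' v_carrier[OF l] by simp
      ultimately have d: "?d = 0\<^sub>v n"
        using nonzero[of ?d l] A u' v_carrier[OF l] by (auto simp: eigenvector_def)
      have "u $ j = (u $ i \<cdot>\<^sub>v v l) $ j" if "j < n" for j
        using arg_cong[OF d, of "\<lambda>v. v $ j"] that u' v_carrier[OF l] by simp
      thus ?thesis
        using u' v_carrier[OF l] by (intro eq_vecI) auto
    qed
    moreover have "w \<bullet> v l = 0"
    proof -
      \<comment> \<open>Orthogonality leaves only the term \<open>k = l\<close>, which is 1 and
        cancels against \<open>v l $ i\<close>.\<close>
      have "(\<Sum>k\<in>?S. (v k \<bullet> v l) / (v k \<bullet> v k)) = (\<Sum>k\<in>{l}. (v k \<bullet> v l) / (v k \<bullet> v k))"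
        using fin l orth by (intro sum.mono_neutral_right) auto
      also have "\<dots> = 1"
        using v_carrier[OF l] scalar_prod_self_eq_0[of "v l" n] by simp
      finally show ?thesis
        using w_dot[OF v_carrier(1)[OF l]] v[of l] l by simp
    qed
    ultimately show ?thesis
      using scalar_prod_smult_distrib[OF w v_carrier(1)[OF l], of "u $ i"] by simp
  qed
  hence "w = 0\<^sub>v n"
    using orthogonal_to_all_eigenvectors_imp_zero[OF A sym w] by blast
  hence "w $ j = 0"
    using j by simp
  thus ?thesis
    using j by (simp add: w_def)
qed

subsection \<open>The Laplacian and the network dynamics\<close>

lemma laplacian_carrier: "laplacian n G \<in> carrier_mat n n"
  by (simp add: laplacian_def)

lemma laplacian_symmetric:
  assumes "symmetric (with_proj G)"
  shows "transpose_mat (laplacian n G) = laplacian n G"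
proof -
  have "p \<in> neighbors G q \<longleftrightarrow> q \<in> neighbors G p" for p q
    using assms by (auto simp: neighbors_def symmetric_def dest: symD)
  thus ?thesis
    by (auto simp: laplacian_def)
qed

text \<open>The degree on the diagonal contributes one copy of \<open>v $ p\<close> per neighbor.
  Since there are no loops and all arcs end in vertices below \<open>n\<close>, the off-diagonal sum
  runs over exactly the neighbors.\<close>

lemma laplacian_mult_vec:
  assumes "pair_graph G" "pverts G = {0..<n}" "v \<in> carrier_vec n" "p < n"
  shows "(laplacian n G *\<^sub>v v) $ p = (\<Sum>q\<in>neighbors G p. v $ p - v $ q)"
proof -
  interpret pair_graph G by fact
  have N: "neighbors G p \<subseteq> {0..<n} - {p}"
    using in_arcsD2[of p] pair_no_loops assms(2) by (fastforce simp: neighbors_def)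
  have "(laplacian n G *\<^sub>v v) $ p =
      (\<Sum>q\<in>{0..<n}. (if p = q then real (card (neighbors G p))
        else if q \<in> neighbors G p then -1 else 0) * v $ q)"
    using assms by (simp add: laplacian_def scalar_prod_def)
  also have "\<dots> = real (card (neighbors G p)) * v $ p +
      (\<Sum>q\<in>{0..<n} - {p}. (if p = q then real (card (neighbors G p))
        else if q \<in> neighbors G p then -1 else 0) * v $ q)"
    using assms by (subst sum.remove[of _ p]) auto
  also have "(\<Sum>q\<in>{0..<n} - {p}. (if p = q then real (card (neighbors G p))
        else if q \<in> neighbors G p then -1 else 0) * v $ q) = (\<Sum>q\<in>neighbors G p. - (v $ q))"
    using N by (intro sum.mono_neutral_cong_right) auto
  finally show ?thesis
    by (simp add: sum_subtractf sum_negf)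
qed

text \<open>At an entry \<open>p\<close> of an eigenvector of largest absolute value no neighbor
  outweighs \<open>v $ p\<close>, so all terms of row \<open>p\<close> have the sign of
  \<open>v $ p\<close> or are 0. Consequently the frequencies \<open>1 + k\<close> are
  positive.\<close>

lemma laplacian_eigenvalue_nonneg:
  assumes "pair_graph G" "pverts G = {0..<n}" "eigenvalue (laplacian n G) k"
  shows "0 \<le> k"
proof -
  interpret pair_graph G by fact
  obtain v where v: "v \<in> carrier_vec n" "v \<noteq> 0\<^sub>v n" "laplacian n G *\<^sub>v v = k \<cdot>\<^sub>v v"
    using assms laplacian_carrier[of n G] by (auto simp: eigenvalue_def eigenvector_def)
  then obtain q where q: "q < n" "v $ q \<noteq> 0"
    by (metis carrier_vecD eq_vecI index_zero_vec)
  have "Max ((\<lambda>p. \<bar>v $ p\<bar>) ` {0..<n}) \<in> (\<lambda>p. \<bar>v $ p\<bar>) ` {0..<n}"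
    using q(1) by (intro Max_in) auto
  then obtain p where p: "p \<in> {0..<n}" "\<bar>v $ p\<bar> = Max ((\<lambda>p. \<bar>v $ p\<bar>) ` {0..<n})"
    by auto
  have max: "\<bar>v $ q\<bar> \<le> \<bar>v $ p\<bar>" if "q < n" for q
    unfolding p(2) using that by (intro Max_ge) auto
  have "v $ p \<noteq> 0"
    using max[of q] q by auto
  \<comment> \<open>Gershgorin: row \<open>p\<close> of the eigenvalue equation, multiplied by \<open>v\<^sub>p\<close>\<close>
  have "k * (v $ p)\<^sup>2 = v $ p * (laplacian n G *\<^sub>v v) $ p"
    using p v by (simp add: power2_eq_square)
  also have "\<dots> = (\<Sum>q\<in>neighbors G p. v $ p * (v $ p - v $ q))"
    using laplacian_mult_vec[OF assms(1,2) v(1)] p(1) by (simp add: sum_distrib_left)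
  also have "\<dots> \<ge> 0"
  proof (intro sum_nonneg)
    fix q assume "q \<in> neighbors G p"
    hence "\<bar>v $ q\<bar> \<le> \<bar>v $ p\<bar>"
      using in_arcsD2[of p q] max[of q] assms(2) by (auto simp: neighbors_def)
    hence "\<bar>v $ p\<bar> * \<bar>v $ q\<bar> \<le> \<bar>v $ p\<bar> * \<bar>v $ p\<bar>"
      by (intro mult_left_mono) auto
    moreover have "v $ p * v $ q \<le> \<bar>v $ p\<bar> * \<bar>v $ q\<bar>"
      by (metis abs_ge_self abs_mult)
    ultimately show "0 \<le> v $ p * (v $ p - v $ q)"
      by (simp add: right_diff_distrib)
  qed
  finally show ?thesis
    using \<open>v $ p \<noteq> 0\<close> by (simp add: zero_le_mult_iff)
qed

section \<open>Projection of the dynamics on eigenvectors\<close>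

lemma network_trajectory_component:
  assumes L: "L \<in> carrier_mat n n" and traj: "network_trajectory n L x z"
    and t: "0 \<le> t" and k: "k < n"
  shows "((\<lambda>s. x s $ k) has_real_derivative (z t + L *\<^sub>v z t) $ k) (at t within {0..})"
    and "((\<lambda>s. z s $ k) has_real_derivative (- x t - L *\<^sub>v x t) $ k) (at t within {0..})"
proof -
  have xz: "x s \<in> carrier_vec n" "z s \<in> carrier_vec n" if "0 \<le> s" for s
    using traj that by (auto simp: network_trajectory_def)
  have deriv: "((\<lambda>s. (x s @\<^sub>v z s) $ l) has_real_derivative
      (system_matrix n L *\<^sub>v (x t @\<^sub>v z t)) $ l) (at t within {0..})" if "l < n + n" for l
    using traj t that by (auto simp: network_trajectory_def)
  have sys: "system_matrix n L *\<^sub>v (x t @\<^sub>v z t) = (z t + L *\<^sub>v z t) @\<^sub>v (- x t - L *\<^sub>v x t)"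
    unfolding system_matrix_def using L xz[OF t]
    by (subst four_block_mat_mult_vec[of _ n n _ n _ n])
      (auto simp: add_mult_distrib_mat_vec[of _ n n] minus_mult_distrib_mat_vec[of _ n n])
  have "((\<lambda>s. (x s @\<^sub>v z s) $ k) has_real_derivative (z t + L *\<^sub>v z t) $ k) (at t within {0..})"
    using deriv[of k] k sys L xz[OF t] by simp
  \<comment> \<open>Only at nonnegative times are the dimensions of \<open>x s\<close> and
    \<open>z s\<close> known, so the entries of the concatenation are identified within the
    half-line only.\<close>
  thus "((\<lambda>s. x s $ k) has_real_derivative (z t + L *\<^sub>v z t) $ k) (at t within {0..})"
    by (rule has_field_derivative_transform_within[where d = 1])
      (use t k carrier_vecD[OF xz(1)] carrier_vecD[OF xz(2)] in auto)
  have "((\<lambda>s. (x s @\<^sub>v z s) $ (n + k)) has_real_derivative (- x t - L *\<^sub>v x t) $ k) (at t within {0..})"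
    using deriv[of "n + k"] k sys L xz[OF t] by simp
  thus "((\<lambda>s. z s $ k) has_real_derivative (- x t - L *\<^sub>v x t) $ k) (at t within {0..})"
    by (rule has_field_derivative_transform_within[where d = 1])
      (use t k carrier_vecD[OF xz(1)] carrier_vecD[OF xz(2)] in auto)
qed

text \<open>Symmetry moves \<open>L\<close> onto the eigenvector, where it becomes the factor
  \<open>\<mu>\<close>. The projections of \<open>x\<close> and \<open>z\<close> thus form a
  harmonic oscillator of frequency \<open>1 + \<mu>\<close>.\<close>

lemma network_trajectory_mode:
  assumes L: "L \<in> carrier_mat n n" and sym: "transpose_mat L = L"
    and traj: "network_trajectory n L x z" and v: "eigenvector L v \<mu>" and t: "0 \<le> t"
  shows "x t \<bullet> v = sinusoid (1 + \<mu>) (x 0 \<bullet> v) (z 0 \<bullet> v) t"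
proof (rule harmonic_oscillator_solution[where g = "\<lambda>t. z t \<bullet> v"])
  have v': "v \<in> carrier_vec n" "L *\<^sub>v v = \<mu> \<cdot>\<^sub>v v"
    using v L by (auto simp: eigenvector_def)
  have xz: "x s \<in> carrier_vec n" "z s \<in> carrier_vec n" if "0 \<le> s" for s
    using traj that by (auto simp: network_trajectory_def)
  have L_dot: "(L *\<^sub>v u) \<bullet> v = \<mu> * (u \<bullet> v)" if "u \<in> carrier_vec n" for u
    using symmetric_mat_scalar_prod[OF L sym that v'(1)] that v'
    by (simp add: scalar_prod_smult_distrib[of _ n])
  show "((\<lambda>t. x t \<bullet> v) has_real_derivative (1 + \<mu>) * (z t \<bullet> v)) (at t within {0..})"
    if t: "0 \<le> t" for t
  proof -
    have "((\<lambda>t. \<Sum>k\<in>{0..<n}. x t $ k * v $ k) has_real_derivative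
        (\<Sum>k\<in>{0..<n}. (z t + L *\<^sub>v z t) $ k * v $ k)) (at t within {0..})"
      using network_trajectory_component(1)[OF L traj t]
      by (intro DERIV_sum DERIV_cmult_right) auto
    also have "(\<Sum>k\<in>{0..<n}. (z t + L *\<^sub>v z t) $ k * v $ k) = (z t + L *\<^sub>v z t) \<bullet> v"
      using v' by (simp only: scalar_prod_def carrier_vecD)
    also have "\<dots> = (1 + \<mu>) * (z t \<bullet> v)"
      using L xz[OF t] v' L_dot by (simp add: add_scalar_prod_distrib[of _ n] algebra_simps)
    finally show ?thesis
      using v' by (simp add: scalar_prod_def)
  qed
  show "((\<lambda>t. z t \<bullet> v) has_real_derivative - (1 + \<mu>) * (x t \<bullet> v)) (at t within {0..})"
    if t: "0 \<le> t" for t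
  proof -
    have "((\<lambda>t. \<Sum>k\<in>{0..<n}. z t $ k * v $ k) has_real_derivative
        (\<Sum>k\<in>{0..<n}. (- x t - L *\<^sub>v x t) $ k * v $ k)) (at t within {0..})"
      using network_trajectory_component(2)[OF L traj t]
      by (intro DERIV_sum DERIV_cmult_right) auto
    also have "(\<Sum>k\<in>{0..<n}. (- x t - L *\<^sub>v x t) $ k * v $ k) = (- x t - L *\<^sub>v x t) \<bullet> v"
      using v' by (simp only: scalar_prod_def carrier_vecD)
    also have "\<dots> = - (1 + \<mu>) * (x t \<bullet> v)"
      using L xz[OF t] v' L_dot by (simp add: minus_scalar_prod_distrib[of _ n] algebra_simps)
    finally show ?thesis
      using v' by (simp add: scalar_prod_def)
  qed
qed (rule t)

section \<open>Reading the spectrum off the signal of one agent\<close>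

theorem theorem4:
  fixes n i :: nat
    and G :: "nat pair_pre_digraph"
    and L C :: "real mat"
    and x z :: "real \<Rightarrow> real vec"
    and t0 T :: real
  assumes graph: "pair_graph G"
    and verts: "pverts G = {0..<n}"
    and conn: "Digraph_Component.connected (with_proj G)"
    and L: "L = laplacian n G"
    and trajectory: "network_trajectory n L x z"
    and initial: "\<And>v \<mu>. eigenvector L v \<mu> \<Longrightarrow> \<not> (x 0 \<bullet> v = 0 \<and> z 0 \<bullet> v = 0)"
    and i: "i \<in> {0..<n}"
    and C: "C = mat 1 n (\<lambda>(r, j). if j = i then 1 else 0)"
    and observable: "full_rank (observability_matrix L C)"
    and window: "0 \<le> t0" "0 < T"
  shows "can_estimate_eigenvalues {t0..t0 + T} (\<lambda>t. x t $ i) L"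
proof -
  interpret pair_graph G by fact
  have Lc: "L \<in> carrier_mat n n"
    by (simp add: L laplacian_carrier)
  have sym: "transpose_mat L = L"
    unfolding L by (rule laplacian_symmetric) (rule pair_sym_arcs)
  have i': "i < n"
    using i by simp
  define S where "S = {\<mu>. eigenvalue L \<mu>}"
  have fin: "finite S"
    unfolding S_def by (rule finite_eigenvalues[OF Lc])
  have nonzero: "u $ i \<noteq> 0" if "eigenvector L u \<mu>" for u \<mu>
    using observable_eigenvector_nonzero[OF Lc i' _ that] observable C by simp
  \<comment> \<open>No eigenvector vanishes at \<open>i\<close>, so each can be scaled to have entry
    1 there.\<close>
  have "\<exists>v. eigenvector L v \<mu> \<and> v $ i = 1" if ev: "eigenvalue L \<mu>" for \<mu>
  proof -
    obtain u where u: "eigenvector L u \<mu>"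
      using ev by (auto simp: eigenvalue_def)
    hence u': "u \<in> carrier_vec n" "L *\<^sub>v u = \<mu> \<cdot>\<^sub>v u"
      using Lc by (auto simp: eigenvector_def)
    let ?v = "(1 / u $ i) \<cdot>\<^sub>v u"
    have one: "?v $ i = 1"
      using nonzero[OF u] u' i' by simp
    moreover have "?v \<noteq> 0\<^sub>v n"
      using one i' by (metis index_zero_vec(1) zero_neq_one)
    moreover have "L *\<^sub>v ?v = \<mu> \<cdot>\<^sub>v ?v"
      using u' Lc by (simp add: mult_mat_vec[of _ n n] smult_smult_assoc mult.commute)
    ultimately show ?thesis
      using u' Lc by (intro exI[of _ ?v]) (simp add: eigenvector_def)
  qed
  then obtain v where v: "\<And>\<mu>. eigenvalue L \<mu> \<Longrightarrow> eigenvector L (v \<mu>) \<mu> \<and> v \<mu> $ i = 1"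
    by metis
  have v_carrier: "v \<mu> \<in> carrier_vec n" "v \<mu> \<noteq> 0\<^sub>v n" if "\<mu> \<in> S" for \<mu>
    using v[of \<mu>] that Lc by (auto simp: S_def eigenvector_def)
  define c where "c \<mu> = 1 / (v \<mu> \<bullet> v \<mu>)" for \<mu>
  have c: "c \<mu> \<noteq> 0" if "\<mu> \<in> S" for \<mu>
    using v_carrier[OF that] scalar_prod_self_eq_0[of "v \<mu>" n] by (simp add: c_def)
  \<comment> \<open>\<open>x t $ i\<close> is the scalar product of \<open>x t\<close> with the
    \<open>i\<close>-th unit vector. Expanding the latter in eigenvectors splits the signal into
    modes, each weighted by the nonzero \<open>c \<mu>\<close>.\<close>
  have signal: "x t $ i =
      (\<Sum>\<mu>\<in>S. sinusoid (1 + \<mu>) (c \<mu> * (x 0 \<bullet> v \<mu>)) (c \<mu> * (z 0 \<bullet> v \<mu>)) t)"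
    if t: "0 \<le> t" for t
  proof -
    have "x t $ i = (\<Sum>j\<in>{0..<n}. x t $ j * (if j = i then 1 else 0))"
      using i' by (simp add: if_distrib cong: if_cong)
    also have "\<dots> = (\<Sum>j\<in>{0..<n}. x t $ j * (\<Sum>\<mu>\<in>S. v \<mu> $ j / (v \<mu> \<bullet> v \<mu>)))"
      using unit_vector_eigenvector_expansion[OF Lc sym i' nonzero v] by (simp add: S_def)
    also have "\<dots> = (\<Sum>j\<in>{0..<n}. \<Sum>\<mu>\<in>S. c \<mu> * (x t $ j * v \<mu> $ j))"
      by (simp add: sum_distrib_left c_def)
    also have "\<dots> = (\<Sum>\<mu>\<in>S. \<Sum>j\<in>{0..<n}. c \<mu> * (x t $ j * v \<mu> $ j))"
      by (rule sum.swap)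
    also have "\<dots> = (\<Sum>\<mu>\<in>S. c \<mu> * (x t \<bullet> v \<mu>))"
      using carrier_vecD[OF v_carrier(1)] by (intro sum.cong) (auto simp: scalar_prod_def sum_distrib_left)
    also have "\<dots> = (\<Sum>\<mu>\<in>S. c \<mu> * sinusoid (1 + \<mu>) (x 0 \<bullet> v \<mu>) (z 0 \<bullet> v \<mu>) t)"
      using network_trajectory_mode[OF Lc sym trajectory _ t] v
      by (intro sum.cong) (auto simp: S_def)
    finally show ?thesis
      by (simp only: sinusoid_scale)
  qed
  \<comment> \<open>The assumption on the initial conditions enters here: the mode of
    \<open>\<mu>\<close> has nonzero initial data, hence a positive amplitude.\<close>
  have "\<exists>A \<phi>. 0 < A \<and> (\<forall>t. sinusoid (1 + \<mu>) (c \<mu> * (x 0 \<bullet> v \<mu>)) (c \<mu> * (z 0 \<bullet> v \<mu>)) t =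
      A * sin ((1 + \<mu>) * t + \<phi>))" if "\<mu> \<in> S" for \<mu>
  proof -
    have "c \<mu> * (x 0 \<bullet> v \<mu>) \<noteq> 0 \<or> c \<mu> * (z 0 \<bullet> v \<mu>) \<noteq> 0"
      using initial[of "v \<mu>" \<mu>] v[of \<mu>] c[OF that] that by (auto simp: S_def)
    thus ?thesis
      by (metis sinusoid_amplitude_phase)
  qed
  then obtain A \<phi> where A: "\<And>\<mu>. \<mu> \<in> S \<Longrightarrow> 0 < A \<mu>"
    and \<phi>: "\<And>\<mu> t. \<mu> \<in> S \<Longrightarrow>
      sinusoid (1 + \<mu>) (c \<mu> * (x 0 \<bullet> v \<mu>)) (c \<mu> * (z 0 \<bullet> v \<mu>)) t = A \<mu> * sin ((1 + \<mu>) * t + \<phi> \<mu>)"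
    by metis
  let ?\<Omega> = "(\<lambda>\<mu>. 1 + \<mu>) ` S"
  have "composed_of_sinusoids {t0..t0 + T} (\<lambda>t. x t $ i) ?\<Omega>"
    unfolding composed_of_sinusoids_def
  proof (intro conjI exI)
    show "finite ?\<Omega>"
      using fin by simp
    show "\<forall>\<omega>\<in>?\<Omega>. 0 < \<omega>"
      using laplacian_eigenvalue_nonneg[OF graph verts] by (force simp: S_def L)
    show "\<forall>\<omega>\<in>?\<Omega>. 0 < A (\<omega> - 1)"
      using A by simp
    show "\<forall>t\<in>{t0..t0 + T}. x t $ i = (\<Sum>\<omega>\<in>?\<Omega>. A (\<omega> - 1) * sin (\<omega> * t + \<phi> (\<omega> - 1)))"
      using window signal \<phi> by (simp add: sum.reindex)
  qed
  \<comment> \<open>Inclusion in both directions; \<open>0 < T\<close> makes the window a proper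
    interval.\<close>
  moreover from this have "\<forall>\<Omega>'. composed_of_sinusoids {t0..t0 + T} (\<lambda>t. x t $ i) \<Omega>' \<longrightarrow> \<Omega>' = ?\<Omega>"
    using composed_of_sinusoids_subset window by (metis less_add_same_cancel1 subset_antisym)
  moreover have "(\<lambda>\<omega>. \<omega> - 1) ` ?\<Omega> = {\<mu>. eigenvalue L \<mu>}"
    by (simp add: S_def image_image)
  ultimately show ?thesis
    unfolding can_estimate_eigenvalues_def by blast
qed

end
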